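(* Let $n>2$. The pure twin group $PT_n$ is generated by $PT_{n-1}$ together with the following additional generators: $$\Big\{\big((s_{l-1}s_l)^3\big)^{(\lambda_0\, m_{n-1,l})^{-1}}\ \Big|\ 2\le l\le n-1,\ \lambda_0\in\Lambda_{n-1}\Big\}.$$
   Context: For an integer $n\ge 2$, the twin group $T_n$ is the group generated by $s_1,\dots,s_{n-1}$ with defining relations $s_i^2=1$ for $1\le i\le n-1$ and $s_is_j=s_js_i$ for $|i-j|\ge 2$. The pure twin group $PT_n$ is the kernel of the homomorphism $\pi:T_n\to S_n$ to the symmetric group on $\{1,\dots,n\}$ that maps $s_i$ to the transposition $(i,i+1)$. The group $T_{n-1}$ is regarded as the subgroup $\langle s_1,\dots,s_{n-2}\rangle$ of $T_n$ (via $s_i\mapsto s_i$), so that $PT_{n-1}\le PT_n$. Notation: $a^b=b^{-1}ab$. For $k\ge 1$ and $0\le i<k$ put $m_{k,i}=s_ks_{k-1}\cdots s_{i+1}$, and put $m_{k,k}=1$. The set $\Lambda_n=\{m_{1,i_1}m_{2,i_2}\cdots m_{n-1,i_{n-1}}\mid 0\le i_k\le k \text{ for each } 1\le k\le n-1\}\subset T_n$ is the Schreier set of coset representatives of $PT_n$ in $T_n$ used throughout. *)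

theory Defs
  imports
    "HOL-Algebra.Generated_Groups"
    "HOL-Algebra.Sym_Groups"
begin

section \<open>Groups given by generators and relations\<close>

text \<open>A letter \<open>(g, True)\<close> stands for the generator \<open>g\<close>, a letter \<open>(g, False)\<close> for its formal
  inverse. A relation \<open>u = v\<close> is the pair of words \<open>(u, v)\<close>.\<close>

type_synonym 'g word = "('g \<times> bool) list"

inductive_set presented_cong :: "'g set \<Rightarrow> ('g word \<times> 'g word) set \<Rightarrow> ('g word \<times> 'g word) set"
  for S :: "'g set" and R :: "('g word \<times> 'g word) set"
where
  refl: "w \<in> lists (S \<times> UNIV) \<Longrightarrow> (w, w) \<in> presented_cong S R"
| sym: "(u, v) \<in> presented_cong S R \<Longrightarrow> (v, u) \<in> presented_cong S R"
| trans: "(u, v) \<in> presented_cong S R \<Longrightarrow> (v, w) \<in> presented_cong S R \<Longrightarrow> (u, w) \<in> presented_cong S R"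
| app: "(u, v) \<in> presented_cong S R \<Longrightarrow> (u', v') \<in> presented_cong S R \<Longrightarrow>
    (u @ u', v @ v') \<in> presented_cong S R"
| cancel: "g \<in> S \<Longrightarrow> ([(g, b), (g, \<not> b)], []) \<in> presented_cong S R"
| rel: "(u, v) \<in> R \<Longrightarrow> u \<in> lists (S \<times> UNIV) \<Longrightarrow> v \<in> lists (S \<times> UNIV) \<Longrightarrow>
    (u, v) \<in> presented_cong S R"

definition presented_group :: "'g set \<Rightarrow> ('g word \<times> 'g word) set \<Rightarrow> 'g word set monoid" where
  "presented_group S R =
    \<lparr> carrier = lists (S \<times> UNIV) // presented_cong S R,
      mult = (\<lambda>X Y. \<Union>x\<in>X. \<Union>y\<in>Y. presented_cong S R `` {x @ y}),
      one = presented_cong S R `` {[]} \<rparr>"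

definition presented_gen :: "'g set \<Rightarrow> ('g word \<times> 'g word) set \<Rightarrow> 'g \<Rightarrow> 'g word set" where
  "presented_gen S R g = presented_cong S R `` {[(g, True)]}"

definition list_mult :: "('a, 'b) monoid_scheme \<Rightarrow> 'a list \<Rightarrow> 'a" where
  "list_mult G xs = foldr (\<otimes>\<^bsub>G\<^esub>) xs \<one>\<^bsub>G\<^esub>"

definition word_eval :: "('a, 'b) monoid_scheme \<Rightarrow> ('g \<Rightarrow> 'a) \<Rightarrow> 'g word \<Rightarrow> 'a" where
  "word_eval G f w = list_mult G (map (\<lambda>(g, b). if b then f g else inv\<^bsub>G\<^esub> (f g)) w)"

text \<open>The homomorphism induced by an assignment \<open>f\<close> of the generators; it is well defined when
  \<open>f\<close> respects the relations, see \<open>presented_lift_hom\<close> and \<open>presented_lift_gen\<close>.\<close>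

definition presented_lift :: "('a, 'b) monoid_scheme \<Rightarrow> ('g \<Rightarrow> 'a) \<Rightarrow> 'g word set \<Rightarrow> 'a" where
  "presented_lift G f X = the_elem (word_eval G f ` X)"

lemma presented_cong_lists:
  "(u, v) \<in> presented_cong S R \<Longrightarrow> u \<in> lists (S \<times> UNIV) \<and> v \<in> lists (S \<times> UNIV)"
  by (induction rule: presented_cong.induct) (auto simp: in_lists_conv_set)

lemma equiv_presented_cong: "equiv (lists (S \<times> UNIV)) (presented_cong S R)"
proof (rule equivI)
  show "presented_cong S R \<subseteq> lists (S \<times> UNIV) \<times> lists (S \<times> UNIV)"
    by (rule subrelI) (drule presented_cong_lists, simp only: mem_Sigma_iff)
  show "refl_on (lists (S \<times> UNIV)) (presented_cong S R)"
    by (rule refl_onI) (rule presented_cong.refl)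
  show "Relation.sym (presented_cong S R)"
    by (rule symI) (rule presented_cong.sym)
  show "Relation.trans (presented_cong S R)"
    by (rule transI) (rule presented_cong.trans)
qed

lemma presented_mult_class:
  assumes "u \<in> lists (S \<times> UNIV)" "v \<in> lists (S \<times> UNIV)"
  shows "presented_cong S R `` {u} \<otimes>\<^bsub>presented_group S R\<^esub> presented_cong S R `` {v} =
    presented_cong S R `` {u @ v}"
proof -
  have "presented_cong S R `` {x @ y} = presented_cong S R `` {u @ v}"
    if "(u, x) \<in> presented_cong S R" "(v, y) \<in> presented_cong S R" for x y
    by (rule equiv_class_eq[OF equiv_presented_cong, symmetric]) (rule presented_cong.app[OF that])
  moreover have "u \<in> presented_cong S R `` {u}" "v \<in> presented_cong S R `` {v}"
    using assms by (auto intro: presented_cong.refl)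
  ultimately show ?thesis unfolding presented_group_def monoid.simps by blast
qed

lemma presented_carrierE:
  assumes "X \<in> carrier (presented_group S R)"
  obtains w where "w \<in> lists (S \<times> UNIV)" "X = presented_cong S R `` {w}"
  using assms unfolding presented_group_def quotient_def monoid.simps partial_object.simps by blast

lemma presented_class_carrier:
  "w \<in> lists (S \<times> UNIV) \<Longrightarrow> presented_cong S R `` {w} \<in> carrier (presented_group S R)"
  unfolding presented_group_def monoid.simps partial_object.simps by (rule quotientI)

lemma presented_one: "\<one>\<^bsub>presented_group S R\<^esub> = presented_cong S R `` {[]}"
  by (simp add: presented_group_def)

lemma presented_inverse_word:
  "w \<in> lists (S \<times> UNIV) \<Longrightarrow>
    (rev (map (\<lambda>(g, b). (g, \<not> b)) w) @ w, []) \<in> presented_cong S R"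
proof (induction w)
  case Nil
  then show ?case by (auto intro: presented_cong.refl)
next
  case (Cons a w)
  obtain g b where a: "a = (g, b)" by (cases a)
  let ?v = "rev (map (\<lambda>(g, b). (g, \<not> b)) w)"
  from Cons have g: "g \<in> S" and w: "w \<in> lists (S \<times> UNIV)"
    and IH: "(?v @ w, []) \<in> presented_cong S R" by (auto simp: a)
  have v: "?v \<in> lists (S \<times> UNIV)" using w by (auto simp: in_lists_conv_set)
  have "([(g, \<not> b), (g, b)], []) \<in> presented_cong S R"
    using presented_cong.cancel[OF g, of "\<not> b"] by simp
  from presented_cong.app[OF presented_cong.refl[OF v] presented_cong.app[OF this presented_cong.refl[OF w]]]
  have "(?v @ [(g, \<not> b), (g, b)] @ w, ?v @ w) \<in> presented_cong S R" by simp
  from presented_cong.trans[OF this IH] show ?case by (simp add: a)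
qed

lemma presented_group_group: "group (presented_group S R)"
proof (rule groupI)
  fix X Y assume "X \<in> carrier (presented_group S R)" "Y \<in> carrier (presented_group S R)"
  then show "X \<otimes>\<^bsub>presented_group S R\<^esub> Y \<in> carrier (presented_group S R)"
    by (elim presented_carrierE) (simp add: presented_mult_class presented_class_carrier)
next
  show "\<one>\<^bsub>presented_group S R\<^esub> \<in> carrier (presented_group S R)"
    by (auto simp: presented_one intro!: presented_class_carrier)
next
  fix X Y Z assume "X \<in> carrier (presented_group S R)" "Y \<in> carrier (presented_group S R)"
    "Z \<in> carrier (presented_group S R)"
  then show "X \<otimes>\<^bsub>presented_group S R\<^esub> Y \<otimes>\<^bsub>presented_group S R\<^esub> Z =
      X \<otimes>\<^bsub>presented_group S R\<^esub> (Y \<otimes>\<^bsub>presented_group S R\<^esub> Z)"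
    by (elim presented_carrierE) (simp add: presented_mult_class)
next
  fix X assume "X \<in> carrier (presented_group S R)"
  then show "\<one>\<^bsub>presented_group S R\<^esub> \<otimes>\<^bsub>presented_group S R\<^esub> X = X"
    by (elim presented_carrierE) (simp add: presented_mult_class presented_one)
next
  fix X assume "X \<in> carrier (presented_group S R)"
  then obtain w where w: "w \<in> lists (S \<times> UNIV)" "X = presented_cong S R `` {w}"
    by (rule presented_carrierE)
  let ?v = "rev (map (\<lambda>(g, b). (g, \<not> b)) w)"
  have v: "?v \<in> lists (S \<times> UNIV)" using w by (auto simp: in_lists_conv_set)
  have "presented_cong S R `` {?v} \<otimes>\<^bsub>presented_group S R\<^esub> X = \<one>\<^bsub>presented_group S R\<^esub>"
    unfolding w(2) presented_mult_class[OF v w(1)] presented_one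
    by (rule equiv_class_eq[OF equiv_presented_cong]) (rule presented_inverse_word[OF w(1)])
  then show "\<exists>Y\<in>carrier (presented_group S R). Y \<otimes>\<^bsub>presented_group S R\<^esub> X = \<one>\<^bsub>presented_group S R\<^esub>"
    using presented_class_carrier[OF v] by blast
qed

lemma presented_gen_carrier: "g \<in> S \<Longrightarrow> presented_gen S R g \<in> carrier (presented_group S R)"
  by (simp add: presented_gen_def presented_class_carrier)

lemma presented_gen_rel:
  assumes "(u, v) \<in> R" "u \<in> lists (S \<times> UNIV)" "v \<in> lists (S \<times> UNIV)"
  shows "presented_cong S R `` {u} = presented_cong S R `` {v}"
  by (rule equiv_class_eq[OF equiv_presented_cong]) (rule presented_cong.rel[OF assms])

context group
begin

lemma word_eval_closed:
  "f ` S \<subseteq> carrier G \<Longrightarrow> w \<in> lists (S \<times> UNIV) \<Longrightarrow> word_eval G f w \<in> carrier G"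
  by (induction w) (auto simp: word_eval_def list_mult_def)

lemma word_eval_append:
  assumes "f ` S \<subseteq> carrier G" "v \<in> lists (S \<times> UNIV)"
  shows "u \<in> lists (S \<times> UNIV) \<Longrightarrow> word_eval G f (u @ v) = word_eval G f u \<otimes> word_eval G f v"
proof (induction u)
  case Nil
  then show ?case using word_eval_closed[OF assms]
    by (simp add: word_eval_def list_mult_def)
next
  case (Cons a u)
  have step: "word_eval G f (a # w) = (case a of (g, b) \<Rightarrow> if b then f g else inv (f g)) \<otimes> word_eval G f w" for w
    by (simp add: word_eval_def list_mult_def split: prod.splits)
  have "(case a of (g, b) \<Rightarrow> if b then f g else inv (f g)) \<in> carrier G"
    using Cons.prems assms(1) by (auto split: prod.splits)
  then show ?case using Cons word_eval_closed[OF assms] word_eval_closed[OF assms(1), of u]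
    by (simp add: step m_assoc)
qed

lemma word_eval_cong:
  assumes f: "f ` S \<subseteq> carrier G" and R: "\<forall>(u, v)\<in>R. word_eval G f u = word_eval G f v"
  shows "(u, v) \<in> presented_cong S R \<Longrightarrow> word_eval G f u = word_eval G f v"
proof (induction rule: presented_cong.induct)
  case (app u v u' v')
  then show ?case
    using word_eval_append[OF f, of u' u] word_eval_append[OF f, of v' v]
      presented_cong_lists[OF app(1)] presented_cong_lists[OF app(2)] by simp
next
  case (cancel g b)
  then have "f g \<in> carrier G" using f by auto
  then show ?case by (simp add: word_eval_def list_mult_def)
next
  case (rel u v)
  then show ?case using R by blast
qed auto

lemma presented_lift_class:
  assumes f: "f ` S \<subseteq> carrier G" and R: "\<forall>(u, v)\<in>R. word_eval G f u = word_eval G f v"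
    and w: "w \<in> lists (S \<times> UNIV)"
  shows "presented_lift G f (presented_cong S R `` {w}) = word_eval G f w"
proof -
  have "word_eval G f ` (presented_cong S R `` {w}) =
      (\<lambda>_. word_eval G f w) ` (presented_cong S R `` {w})"
    by (rule image_cong) (use word_eval_cong[OF f R, where u = w] in \<open>simp_all add: Image_singleton_iff\<close>)
  also have "\<dots> = {word_eval G f w}"
    using presented_cong.refl[OF w, of R] by (intro image_constant) (simp add: Image_singleton_iff)
  finally have "word_eval G f ` (presented_cong S R `` {w}) = {word_eval G f w}" .
  then show ?thesis by (simp add: presented_lift_def)
qed

lemma presented_lift_hom:
  assumes f: "f ` S \<subseteq> carrier G" and R: "\<forall>(u, v)\<in>R. word_eval G f u = word_eval G f v"
  shows "presented_lift G f \<in> hom (presented_group S R) G"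
proof (rule homI)
  fix X assume "X \<in> carrier (presented_group S R)"
  then show "presented_lift G f X \<in> carrier G"
    by (elim presented_carrierE) (simp add: presented_lift_class[OF f R] word_eval_closed[OF f])
next
  fix X Y assume "X \<in> carrier (presented_group S R)" "Y \<in> carrier (presented_group S R)"
  then show "presented_lift G f (X \<otimes>\<^bsub>presented_group S R\<^esub> Y) = presented_lift G f X \<otimes> presented_lift G f Y"
    by (elim presented_carrierE)
      (simp add: presented_lift_class[OF f R] presented_mult_class word_eval_append[OF f])
qed

lemma presented_lift_gen:
  assumes f: "f ` S \<subseteq> carrier G" and R: "\<forall>(u, v)\<in>R. word_eval G f u = word_eval G f v"
    and g: "g \<in> S"
  shows "presented_lift G f (presented_gen S R g) = f g"
proof -
  have "f g \<in> carrier G" using f g by auto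
  then show ?thesis using presented_lift_class[OF f R, of "[(g, True)]"] g
    by (simp add: presented_gen_def word_eval_def list_mult_def)
qed

end


section \<open>Twin groups\<close>

definition twin_rels :: "nat \<Rightarrow> (nat word \<times> nat word) set" where
  "twin_rels n =
    {([(i, True), (i, True)], []) | i. i \<in> {1..<n}} \<union>
    {([(i, True), (j, True)], [(j, True), (i, True)]) | i j.
       i \<in> {1..<n} \<and> j \<in> {1..<n} \<and> \<bar>int i - int j\<bar> \<ge> 2}"

definition twin_group :: "nat \<Rightarrow> nat word set monoid" where
  "twin_group n = presented_group {1..<n} (twin_rels n)"

definition twin_gen :: "nat \<Rightarrow> nat \<Rightarrow> nat word set" where
  "twin_gen n i = presented_gen {1..<n} (twin_rels n) i"

definition twin_perm :: "nat \<Rightarrow> nat word set \<Rightarrow> (nat \<Rightarrow> nat)" where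
  "twin_perm n = presented_lift (sym_group n) (\<lambda>i. Transposition.transpose i (i + 1))"

definition pure_twin :: "nat \<Rightarrow> nat word set set" where
  "pure_twin n = kernel (twin_group n) (sym_group n) (twin_perm n)"

text \<open>For \<open>m \<le> n\<close>, the map from the twin group on \<open>m\<close> strands to the one on \<open>n\<close> strands that
  sends \<open>s\<^sub>i\<close> to \<open>s\<^sub>i\<close>.\<close>

definition twin_incl :: "nat \<Rightarrow> nat \<Rightarrow> nat word set \<Rightarrow> nat word set" where
  "twin_incl m n = presented_lift (twin_group n) (twin_gen n)"

text \<open>The element \<open>s\<^sub>k s\<^bsub>k-1\<^esub> \<cdots> s\<^bsub>i+1\<^esub>\<close> of the twin group on \<open>n\<close> strands; the product is empty
  for \<open>i = k\<close>.\<close>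

definition twin_m :: "nat \<Rightarrow> nat \<Rightarrow> nat \<Rightarrow> nat word set" where
  "twin_m n k i = list_mult (twin_group n) (map (twin_gen n) (rev [i + 1..<k + 1]))"

definition schreier_set :: "nat \<Rightarrow> nat word set set" where
  "schreier_set n =
    {list_mult (twin_group n) (map (\<lambda>k. twin_m n k (i k)) [1..<n]) | i. \<forall>k\<in>{1..<n}. i k \<le> k}"

definition conj_by :: "('a, 'b) monoid_scheme \<Rightarrow> 'a \<Rightarrow> 'a \<Rightarrow> 'a" where
  "conj_by G a b = inv\<^bsub>G\<^esub> b \<otimes>\<^bsub>G\<^esub> a \<otimes>\<^bsub>G\<^esub> b"

lemma twin_group_group: "group (twin_group n)"
  by (simp add: twin_group_def presented_group_group)

lemma twin_gen_carrier: "i \<in> {1..<n} \<Longrightarrow> twin_gen n i \<in> carrier (twin_group n)"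
  unfolding twin_group_def twin_gen_def by (rule presented_gen_carrier)

lemma twin_gen_square:
  assumes "i \<in> {1..<n}"
  shows "twin_gen n i \<otimes>\<^bsub>twin_group n\<^esub> twin_gen n i = \<one>\<^bsub>twin_group n\<^esub>"
proof -
  have "presented_cong {1..<n} (twin_rels n) `` {[(i, True), (i, True)]} =
      presented_cong {1..<n} (twin_rels n) `` {[]}"
    by (rule presented_gen_rel) (use assms in \<open>auto simp: twin_rels_def\<close>)
  then show ?thesis using assms
    by (simp add: twin_group_def twin_gen_def presented_gen_def presented_mult_class presented_one)
qed

lemma twin_gen_commute:
  assumes "i \<in> {1..<n}" "j \<in> {1..<n}" "\<bar>int i - int j\<bar> \<ge> 2"
  shows "twin_gen n i \<otimes>\<^bsub>twin_group n\<^esub> twin_gen n j = twin_gen n j \<otimes>\<^bsub>twin_group n\<^esub> twin_gen n i"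
proof -
  have "presented_cong {1..<n} (twin_rels n) `` {[(i, True), (j, True)]} =
      presented_cong {1..<n} (twin_rels n) `` {[(j, True), (i, True)]}"
    by (rule presented_gen_rel) (use assms in \<open>auto simp: twin_rels_def\<close>)
  then show ?thesis using assms
    by (simp add: twin_group_def twin_gen_def presented_gen_def presented_mult_class)
qed

lemma (in group) twin_rels_eval:
  assumes "f ` {1..<n} \<subseteq> carrier G"
    and "\<And>i. i \<in> {1..<n} \<Longrightarrow> f i \<otimes> f i = \<one>"
    and "\<And>i j. i \<in> {1..<n} \<Longrightarrow> j \<in> {1..<n} \<Longrightarrow> \<bar>int i - int j\<bar> \<ge> 2 \<Longrightarrow> f i \<otimes> f j = f j \<otimes> f i"
  shows "\<forall>(u, v)\<in>twin_rels n. word_eval G f u = word_eval G f v"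
proof -
  have "word_eval G f u = word_eval G f v" if uv: "(u, v) \<in> twin_rels n" for u v
  proof -
    have c: "f i \<in> carrier G" if "i \<in> {1..<n}" for i using assms(1) that by auto
    from uv consider
        (a) i where "i \<in> {1..<n}" "u = [(i, True), (i, True)]" "v = []"
      | (b) i j where "i \<in> {1..<n}" "j \<in> {1..<n}" "\<bar>int i - int j\<bar> \<ge> 2"
          "u = [(i, True), (j, True)]" "v = [(j, True), (i, True)]"
      unfolding twin_rels_def by blast
    then show ?thesis
    proof cases
      case a
      then show ?thesis using c[OF a(1)] assms(2)[OF a(1)] by (simp add: word_eval_def list_mult_def)
    next
      case b
      then show ?thesis using c[OF b(1)] c[OF b(2)] assms(3)[OF b(1,2,3)]
        by (simp add: word_eval_def list_mult_def)
    qed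
  qed
  then show ?thesis by blast
qed

lemma twin_perm_assignment:
  fixes n :: nat
  defines "f \<equiv> (\<lambda>i::nat. Transposition.transpose i (i + 1))"
  shows "f ` {1..<n} \<subseteq> carrier (sym_group n)"
    and "\<forall>(u, v)\<in>twin_rels n. word_eval (sym_group n) f u = word_eval (sym_group n) f v"
proof -
  show *: "f ` {1..<n} \<subseteq> carrier (sym_group n)"
    by (auto simp: f_def sym_group_carrier intro!: permutes_swap_id)
  show "\<forall>(u, v)\<in>twin_rels n. word_eval (sym_group n) f u = word_eval (sym_group n) f v"
  proof (rule group.twin_rels_eval[OF sym_group_is_group *])
    show "f i \<otimes>\<^bsub>sym_group n\<^esub> f i = \<one>\<^bsub>sym_group n\<^esub>" for i
      by (simp add: f_def sym_group_mult sym_group_one)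
    show "f i \<otimes>\<^bsub>sym_group n\<^esub> f j = f j \<otimes>\<^bsub>sym_group n\<^esub> f i" if "\<bar>int i - int j\<bar> \<ge> 2" for i j
      using that by (auto simp: f_def sym_group_mult fun_eq_iff Transposition.transpose_def)
  qed
qed

lemma twin_perm_hom: "twin_perm n \<in> hom (twin_group n) (sym_group n)"
  unfolding twin_perm_def twin_group_def
  by (rule group.presented_lift_hom[OF sym_group_is_group twin_perm_assignment])

lemma twin_perm_gen:
  "i \<in> {1..<n} \<Longrightarrow> twin_perm n (twin_gen n i) = Transposition.transpose i (i + 1)"
  unfolding twin_perm_def twin_gen_def
  by (rule group.presented_lift_gen[OF sym_group_is_group twin_perm_assignment])

lemma twin_incl_assignment:
  assumes "m \<le> n"
  shows "twin_gen n ` {1..<m} \<subseteq> carrier (twin_group n)"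
    and "\<forall>(u, v)\<in>twin_rels m.
      word_eval (twin_group n) (twin_gen n) u = word_eval (twin_group n) (twin_gen n) v"
proof -
  show *: "twin_gen n ` {1..<m} \<subseteq> carrier (twin_group n)"
    using assms by (auto intro!: twin_gen_carrier)
  show "\<forall>(u, v)\<in>twin_rels m.
      word_eval (twin_group n) (twin_gen n) u = word_eval (twin_group n) (twin_gen n) v"
    by (rule group.twin_rels_eval[OF twin_group_group *])
      (rule twin_gen_square twin_gen_commute; use assms in simp)+
qed

lemma twin_incl_hom: "m \<le> n \<Longrightarrow> twin_incl m n \<in> hom (twin_group m) (twin_group n)"
  unfolding twin_incl_def twin_group_def[of m]
  by (rule group.presented_lift_hom[OF twin_group_group twin_incl_assignment])

lemma twin_incl_gen:
  "m \<le> n \<Longrightarrow> i \<in> {1..<m} \<Longrightarrow> twin_incl m n (twin_gen m i) = twin_gen n i"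
  unfolding twin_incl_def twin_gen_def[of m]
  by (rule group.presented_lift_gen[OF twin_group_group twin_incl_assignment])

text \<open>The map \<open>twin_incl m n\<close> is injective: killing the generators \<open>s\<^sub>i\<close> with \<open>i \<ge> m\<close> is a left inverse.\<close>

lemma twin_incl_class:
  assumes "m \<le> n" "w \<in> lists ({1..<m} \<times> UNIV)"
  shows "twin_incl m n (presented_cong {1..<m} (twin_rels m) `` {w}) =
    word_eval (twin_group n) (twin_gen n) w"
  unfolding twin_incl_def
  by (rule group.presented_lift_class[OF twin_group_group twin_incl_assignment[OF assms(1)] assms(2)])

lemma word_eval_twin_gen:
  "w \<in> lists ({1..<n} \<times> UNIV) \<Longrightarrow>
    word_eval (twin_group n) (twin_gen n) w = presented_cong {1..<n} (twin_rels n) `` {w}"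
proof (induction w)
  case Nil
  then show ?case by (simp add: word_eval_def list_mult_def twin_group_def presented_one)
next
  case (Cons a w)
  obtain i b where a: "a = (i, b)" by (cases a)
  interpret group "twin_group n" by (rule twin_group_group)
  from Cons have i: "i \<in> {1..<n}" and w: "w \<in> lists ({1..<n} \<times> UNIV)" by (auto simp: a)
  have "presented_cong {1..<n} (twin_rels n) `` {[(i, False)]} \<otimes>\<^bsub>twin_group n\<^esub> twin_gen n i =
      \<one>\<^bsub>twin_group n\<^esub>"
    using i presented_cong.cancel[OF i, of False "twin_rels n"]
      equiv_class_eq[OF equiv_presented_cong[of "{1..<n}" "twin_rels n"]]
    by (simp add: twin_group_def twin_gen_def presented_gen_def presented_mult_class presented_one)
  then have inv: "inv\<^bsub>twin_group n\<^esub> (twin_gen n i) = presented_cong {1..<n} (twin_rels n) `` {[(i, False)]}"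
  proof (rule inv_equality)
    show "twin_gen n i \<in> carrier (twin_group n)" using i by (rule twin_gen_carrier)
    show "presented_cong {1..<n} (twin_rels n) `` {[(i, False)]} \<in> carrier (twin_group n)"
      unfolding twin_group_def by (rule presented_class_carrier) (use i in simp)
  qed
  have "(if b then twin_gen n i else inv\<^bsub>twin_group n\<^esub> (twin_gen n i)) =
      presented_cong {1..<n} (twin_rels n) `` {[(i, b)]}"
    using inv by (simp add: twin_gen_def presented_gen_def)
  moreover have "word_eval (twin_group n) (twin_gen n) (a # w) =
      (if b then twin_gen n i else inv\<^bsub>twin_group n\<^esub> (twin_gen n i)) \<otimes>\<^bsub>twin_group n\<^esub>
        word_eval (twin_group n) (twin_gen n) w"
    by (simp add: word_eval_def list_mult_def a)
  ultimately show ?case using Cons.IH[OF w] i w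
    by (simp add: a twin_group_def presented_mult_class)
qed

lemma twin_incl_inj:
  assumes mn: "m \<le> n"
  shows "inj_on (twin_incl m n) (carrier (twin_group m))"
proof -
  interpret M: group "twin_group m" by (rule twin_group_group)
  define f where "f i = (if i < m then twin_gen m i else \<one>\<^bsub>twin_group m\<^esub>)" for i
  define r where "r = presented_lift (twin_group m) f"
  have f: "f ` {1..<n} \<subseteq> carrier (twin_group m)"
    by (auto simp: f_def intro!: twin_gen_carrier)
  have f_rel: "\<forall>(u, v)\<in>twin_rels n. word_eval (twin_group m) f u = word_eval (twin_group m) f v"
  proof (rule M.twin_rels_eval[OF f])
    show "f i \<otimes>\<^bsub>twin_group m\<^esub> f i = \<one>\<^bsub>twin_group m\<^esub>" if "i \<in> {1..<n}" for i
      using that by (simp add: f_def twin_gen_square)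
    show "f i \<otimes>\<^bsub>twin_group m\<^esub> f j = f j \<otimes>\<^bsub>twin_group m\<^esub> f i"
      if "i \<in> {1..<n}" "j \<in> {1..<n}" "\<bar>int i - int j\<bar> \<ge> 2" for i j
      using that twin_gen_commute[of i m j] by (cases "i < m"; cases "j < m")
        (simp_all add: f_def twin_gen_carrier)
  qed
  have "r (twin_incl m n X) = X" if X: "X \<in> carrier (twin_group m)" for X
  proof -
    from X obtain w where w: "w \<in> lists ({1..<m} \<times> UNIV)"
      and X_eq: "X = presented_cong {1..<m} (twin_rels m) `` {w}"
      unfolding twin_group_def by (rule presented_carrierE)
    have w': "w \<in> lists ({1..<n} \<times> UNIV)" using w mn by (fastforce simp: in_lists_conv_set)
    have f_gen: "f (fst x) = twin_gen m (fst x)" if "x \<in> set w" for x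
      using that w by (force simp: f_def in_lists_conv_set)
    have "r (twin_incl m n X) = word_eval (twin_group m) f w"
      unfolding X_eq r_def twin_incl_class[OF mn w] word_eval_twin_gen[OF w']
      by (rule M.presented_lift_class[OF f f_rel w'])
    also have "\<dots> = word_eval (twin_group m) (twin_gen m) w"
      unfolding word_eval_def
      by (rule arg_cong[where f = "list_mult (twin_group m)"], rule map_cong)
        (simp_all add: f_gen case_prod_beta)
    also have "\<dots> = X" using word_eval_twin_gen[OF w] by (simp add: X_eq)
    finally show ?thesis .
  qed
  then show ?thesis by (metis inj_onI)
qed

end

theory Submission
  imports Defs
begin

text \<open>Let \<open>H\<close> be the subgroup generated by the listed elements, all of which lie in \<open>PT\<^sub>n\<close>. The set
  \<open>H \<Lambda>\<^sub>n\<close> contains \<open>1\<close> and is closed under right multiplication by every \<open>s\<^sub>j\<close>, so it is all of \<open>T\<^sub>n\<close>: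
  with \<open>k = n - 1\<close>, the product \<open>m\<^bsub>k,i\<^esub> s\<^sub>j\<close> is \<open>m\<^bsub>k,i-1\<^esub>\<close>, \<open>m\<^bsub>k,i+1\<^esub>\<close> or \<open>s\<^sub>j m\<^bsub>k,i\<^esub>\<close> for \<open>j \<le> i + 1\<close>,
  and for \<open>j > i + 1\<close> it is \<open>d\<inverse> s\<^bsub>j-1\<^esub> m\<^bsub>k,i\<^esub>\<close> with \<open>d\<close> the conjugate \<open>m\<^bsub>k,j\<^esub> (s\<^bsub>j-1\<^esub> s\<^sub>j)\<^sup>3 m\<^bsub>k,j\<^esub>\<inverse>\<close>;
  the letter of \<open>T\<^bsub>n-1\<^esub>\<close> that has been moved to the left is absorbed by
  \<open>T\<^bsub>n-1\<^esub> = PT\<^bsub>n-1\<^esub> \<Lambda>\<^bsub>n-1\<^esub>\<close>. Finally, \<open>1\<close> is the only element of \<open>\<Lambda>\<^sub>n\<close> with trivial permutation, so an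
  element \<open>h \<lambda>\<close> of \<open>PT\<^sub>n\<close> with \<open>h \<in> H\<close> has \<open>\<lambda> = 1\<close>.\<close>

section \<open>Products of lists and a word identity in an arbitrary group\<close>

context group
begin

lemma list_mult_closed: "set xs \<subseteq> carrier G \<Longrightarrow> list_mult G xs \<in> carrier G"
  by (induction xs) (auto simp: list_mult_def)

lemma list_mult_append:
  "set xs \<subseteq> carrier G \<Longrightarrow> set ys \<subseteq> carrier G \<Longrightarrow>
    list_mult G (xs @ ys) = list_mult G xs \<otimes> list_mult G ys"
proof (induction xs)
  case Nil
  then show ?case using list_mult_closed[of ys] by (simp add: list_mult_def)
next
  case (Cons x xs)
  then show ?case using list_mult_closed[of xs] list_mult_closed[of ys]
    by (simp add: list_mult_def m_assoc)
qed

lemma list_mult_commute: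
  assumes "x \<in> carrier G"
  shows "set ys \<subseteq> carrier G \<Longrightarrow> (\<And>y. y \<in> set ys \<Longrightarrow> x \<otimes> y = y \<otimes> x) \<Longrightarrow>
    x \<otimes> list_mult G ys = list_mult G ys \<otimes> x"
proof (induction ys)
  case Nil
  then show ?case using assms by (simp add: list_mult_def)
next
  case (Cons y ys)
  let ?p = "list_mult G ys"
  have c: "y \<in> carrier G" "?p \<in> carrier G" using Cons.prems list_mult_closed[of ys] by auto
  have IH: "x \<otimes> ?p = ?p \<otimes> x" using Cons by auto
  have y: "x \<otimes> y = y \<otimes> x" using Cons.prems by auto
  have "x \<otimes> (y \<otimes> ?p) = y \<otimes> (x \<otimes> ?p)" using assms c y by (metis m_assoc)
  also have "\<dots> = y \<otimes> ?p \<otimes> x" using assms c IH by (metis m_assoc)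
  finally show ?case by (simp add: list_mult_def)
qed

lemma hom_list_mult:
  assumes "group H" "h \<in> hom G H"
  shows "set xs \<subseteq> carrier G \<Longrightarrow> h (list_mult G xs) = list_mult H (map h xs)"
proof (induction xs)
  case Nil
  then show ?case using assms by (simp add: list_mult_def hom_one)
next
  case (Cons x xs)
  then show ?case using assms list_mult_closed[of xs] by (simp add: list_mult_def hom_mult)
qed

text \<open>Since \<open>b\<close> commutes with \<open>r\<close>, cancelling squares reduces
  \<open>(ab)^3 * b a b r\<close> to \<open>a b a r\<close>, and the leftmost \<open>a\<close> then
  passes \<open>m\<close>. In the application \<open>a\<close> and \<open>b\<close> are the
  neighbours s_{j-1} and s_j, \<open>m\<close> is m_{k,j} and \<open>r\<close> is m_{j-2,i}; the
  inverted factor corrects for the missing braid relation.\<close>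

lemma braid_move:
  assumes c: "a \<in> carrier G" "b \<in> carrier G" "m \<in> carrier G" "r \<in> carrier G"
    and sq: "a \<otimes> a = \<one>" "b \<otimes> b = \<one>"
    and am: "a \<otimes> m = m \<otimes> a" and br: "b \<otimes> r = r \<otimes> b"
  shows "m \<otimes> (b \<otimes> (a \<otimes> r)) \<otimes> b =
    inv (m \<otimes> (a \<otimes> b) [^] (3::nat) \<otimes> inv m) \<otimes> (a \<otimes> (m \<otimes> (b \<otimes> (a \<otimes> r))))"
proof -
  \<comment> \<open>The cancellation and commutation rules carry a trailing factor \<open>x\<close>
    so that they rewrite inside right-associated products.\<close>
  have sq': "a \<otimes> (a \<otimes> x) = x" "b \<otimes> (b \<otimes> x) = x" if "x \<in> carrier G" for x
    using that c sq by (simp_all add: m_assoc[symmetric])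
  have im: "inv m \<otimes> (m \<otimes> x) = x" if "x \<in> carrier G" for x
    using that c by (simp add: m_assoc[symmetric])
  have am': "a \<otimes> (m \<otimes> x) = m \<otimes> (a \<otimes> x)" if "x \<in> carrier G" for x
    using that c am by (simp add: m_assoc[symmetric])
  have "(m \<otimes> (a \<otimes> b) [^] (3::nat) \<otimes> inv m) \<otimes> (m \<otimes> (b \<otimes> (a \<otimes> r)) \<otimes> b) =
      a \<otimes> (m \<otimes> (b \<otimes> (a \<otimes> r)))"
    using c by (simp add: numeral_3_eq_3 m_assoc im br[symmetric] sq' am')
  then show ?thesis using c by (simp add: inv_solve_left)
qed

end

section \<open>Induction over twin groups; inclusions and permutations\<close>

lemma twin_gen_inv: "i \<in> {1..<n} \<Longrightarrow> inv\<^bsub>twin_group n\<^esub> (twin_gen n i) = twin_gen n i"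
  by (rule group.inv_equality[OF twin_group_group twin_gen_square])
    (auto intro: twin_gen_carrier)

text \<open>The generators are involutions, so a formal inverse letter evaluates to the generator
  itself and right multiplication by the s_j alone reaches every element.\<close>

lemma twin_group_induct [consumes 1, case_names one gen]:
  assumes X: "X \<in> carrier (twin_group n)"
    and one: "P \<one>\<^bsub>twin_group n\<^esub>"
    and gen: "\<And>X j. X \<in> carrier (twin_group n) \<Longrightarrow> P X \<Longrightarrow> j \<in> {1..<n} \<Longrightarrow>
      P (X \<otimes>\<^bsub>twin_group n\<^esub> twin_gen n j)"
  shows "P X"
proof -
  interpret group "twin_group n" by (rule twin_group_group)
  have gens: "twin_gen n ` {1..<n} \<subseteq> carrier (twin_group n)"
    by (auto intro!: twin_gen_carrier)
  have "P (word_eval (twin_group n) (twin_gen n) w)" if "w \<in> lists ({1..<n} \<times> UNIV)" for w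
    using that
  proof (induction w rule: rev_induct)
    case Nil
    then show ?case using one by (simp add: word_eval_def list_mult_def)
  next
    case (snoc a w)
    obtain j b where a: "a = (j, b)" by (cases a)
    from snoc.prems have j: "j \<in> {1..<n}" and w: "w \<in> lists ({1..<n} \<times> UNIV)" by (auto simp: a)
    have "word_eval (twin_group n) (twin_gen n) [a] = twin_gen n j"
      using twin_gen_inv[OF j] twin_gen_carrier[OF j] by (simp add: a word_eval_def list_mult_def)
    then have "word_eval (twin_group n) (twin_gen n) (w @ [a]) =
        word_eval (twin_group n) (twin_gen n) w \<otimes>\<^bsub>twin_group n\<^esub> twin_gen n j"
      using word_eval_append[OF gens _ w, of "[a]"] snoc.prems by simp
    then show ?case using gen[OF word_eval_closed[OF gens w] snoc.IH[OF w] j] by simp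
  qed
  moreover obtain w where "w \<in> lists ({1..<n} \<times> UNIV)"
    "X = presented_cong {1..<n} (twin_rels n) `` {w}"
    using X unfolding twin_group_def by (rule presented_carrierE)
  ultimately show ?thesis using word_eval_twin_gen by metis
qed

lemma twin_incl_carrier:
  "m \<le> n \<Longrightarrow> X \<in> carrier (twin_group m) \<Longrightarrow> twin_incl m n X \<in> carrier (twin_group n)"
  using twin_incl_hom by (rule hom_in_carrier)

lemma twin_perm_one: "twin_perm n \<one>\<^bsub>twin_group n\<^esub> = id"
  using hom_one[OF twin_perm_hom twin_group_group sym_group_is_group] by (simp add: sym_group_one)

lemma twin_perm_mult:
  "X \<in> carrier (twin_group n) \<Longrightarrow> Y \<in> carrier (twin_group n) \<Longrightarrow>
    twin_perm n (X \<otimes>\<^bsub>twin_group n\<^esub> Y) = twin_perm n X \<circ> twin_perm n Y"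
  using hom_mult[OF twin_perm_hom] by (simp add: sym_group_mult)

lemma twin_perm_permutes: "X \<in> carrier (twin_group n) \<Longrightarrow> twin_perm n X permutes {1..n}"
  using hom_in_carrier[OF twin_perm_hom] by (simp add: sym_group_carrier)

text \<open>Both sides are plain functions on the naturals that fix everything outside the permuted
  interval, so no inclusion of symmetric groups has to be written; agreement on generators
  suffices.\<close>

lemma twin_perm_incl:
  assumes "m \<le> n" "X \<in> carrier (twin_group m)"
  shows "twin_perm n (twin_incl m n X) = twin_perm m X"
  using assms(2)
proof (induction X rule: twin_group_induct)
  case one
  then show ?case
    using hom_one[OF twin_incl_hom[OF assms(1)] twin_group_group twin_group_group]
    by (simp add: twin_perm_one)
next
  case (gen X j)
  then have "j \<in> {1..<n}" using assms(1) by auto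
  then show ?case using gen assms(1)
    by (simp add: hom_mult[OF twin_incl_hom] twin_perm_mult twin_incl_gen twin_perm_gen
        twin_gen_carrier twin_incl_carrier)
qed

section \<open>The elements m_{k,i}\<close>

lemma twin_m_carrier: "k < n \<Longrightarrow> twin_m n k i \<in> carrier (twin_group n)"
  unfolding twin_m_def
  by (rule group.list_mult_closed[OF twin_group_group]) (auto intro!: twin_gen_carrier)

lemma twin_m_self: "twin_m n k k = \<one>\<^bsub>twin_group n\<^esub>"
  by (simp add: twin_m_def list_mult_def)

lemma twin_m_split:
  assumes "i \<le> j" "j \<le> k" "k < n"
  shows "twin_m n k i = twin_m n k j \<otimes>\<^bsub>twin_group n\<^esub> twin_m n j i"
proof -
  have "[i + 1..<k + 1] = [i + 1..<j + 1] @ [j + 1..<k + 1]"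
    using assms upt_add_eq_append[of "i + 1" "j + 1" "k - j"] by simp
  then show ?thesis unfolding twin_m_def using assms
    by (simp only: rev_append map_append)
      (rule group.list_mult_append[OF twin_group_group]; auto intro!: twin_gen_carrier)
qed

lemma twin_m_step:
  assumes "i < k" "k < n"
  shows "twin_m n k i = twin_m n k (i + 1) \<otimes>\<^bsub>twin_group n\<^esub> twin_gen n (i + 1)"
proof -
  interpret group "twin_group n" by (rule twin_group_group)
  have "twin_m n (i + 1) i = twin_gen n (i + 1)"
    using assms twin_gen_carrier[of "i + 1" n] by (simp add: twin_m_def list_mult_def)
  then show ?thesis using twin_m_split[of i "i + 1" k n] assms by simp
qed

text \<open>The letters of m_{k,i} have indices from i+1 to k, and in either case all of them differ
  from j by at least 2.\<close>

lemma twin_m_commute: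
  assumes "j \<in> {1..<n}" "k < n" "j < i \<or> k + 2 \<le> j"
  shows "twin_gen n j \<otimes>\<^bsub>twin_group n\<^esub> twin_m n k i = twin_m n k i \<otimes>\<^bsub>twin_group n\<^esub> twin_gen n j"
  unfolding twin_m_def
proof (rule group.list_mult_commute[OF twin_group_group])
  show "twin_gen n j \<in> carrier (twin_group n)" using assms by (simp add: twin_gen_carrier)
  show "set (map (twin_gen n) (rev [i + 1..<k + 1])) \<subseteq> carrier (twin_group n)"
    using assms by (auto intro!: twin_gen_carrier)
  fix y assume "y \<in> set (map (twin_gen n) (rev [i + 1..<k + 1]))"
  then obtain l where l: "y = twin_gen n l" "i + 1 \<le> l" "l \<le> k" by auto
  show "twin_gen n j \<otimes>\<^bsub>twin_group n\<^esub> y = y \<otimes>\<^bsub>twin_group n\<^esub> twin_gen n j"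
    unfolding l(1) by (rule twin_gen_commute) (use assms l in auto)
qed

lemma twin_incl_m:
  assumes "m \<le> n" "k < m"
  shows "twin_incl m n (twin_m m k i) = twin_m n k i"
proof -
  have "twin_incl m n (twin_m m k i) =
      list_mult (twin_group n) (map (twin_incl m n) (map (twin_gen m) (rev [i + 1..<k + 1])))"
    unfolding twin_m_def
    by (rule group.hom_list_mult[OF twin_group_group twin_group_group twin_incl_hom[OF assms(1)]])
      (use assms in \<open>auto intro!: twin_gen_carrier\<close>)
  moreover have "map (twin_incl m n) (map (twin_gen m) (rev [i + 1..<k + 1])) =
      map (twin_gen n) (rev [i + 1..<k + 1])"
    using assms by (auto intro!: twin_incl_gen)
  ultimately show ?thesis by (simp only: twin_m_def)
qed

text \<open>The rightmost letter acts first, so i+1 is carried step by step up to k+1. This is what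
  lets a permutation determine the index i.\<close>

lemma twin_perm_m:
  assumes "i \<le> k" "k < n"
  shows "twin_perm n (twin_m n k i) (i + 1) = k + 1"
  using assms
proof (induction i rule: inc_induct)
  case base
  then show ?case by (simp add: twin_m_self twin_perm_one)
next
  case (step i)
  then have "i + 1 \<in> {1..<n}" by auto
  then show ?case using step twin_m_step[of i k n]
    by (simp add: twin_perm_mult twin_m_carrier twin_gen_carrier twin_perm_gen)
qed

section \<open>Recursive structure of the Schreier set\<close>

lemma schreier_set_carrier: "x \<in> schreier_set n \<Longrightarrow> x \<in> carrier (twin_group n)"
  unfolding schreier_set_def
  by (auto intro!: group.list_mult_closed[OF twin_group_group] twin_m_carrier)

lemma schreier_set_trivial: "n \<le> 1 \<Longrightarrow> schreier_set n = {\<one>\<^bsub>twin_group n\<^esub>}"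
  by (auto simp: schreier_set_def list_mult_def)

text \<open>This splits off the last factor; the remaining product uses only generators with index
  below k and so comes from the twin group on k strands.\<close>

lemma schreier_set_Suc:
  assumes "1 \<le> k"
  shows "schreier_set (Suc k) =
    {twin_incl k (Suc k) x \<otimes>\<^bsub>twin_group (Suc k)\<^esub> twin_m (Suc k) k i | x i.
      x \<in> schreier_set k \<and> i \<le> k}"
proof -
  interpret group "twin_group (Suc k)" by (rule twin_group_group)
  let ?p = "\<lambda>n m i. list_mult (twin_group n) (map (\<lambda>k. twin_m n k (i k)) [1..<m])"
  have incl: "twin_incl k (Suc k) (?p k k i) = ?p (Suc k) k i" for i
  proof -
    have "twin_incl k (Suc k) (?p k k i) =
      list_mult (twin_group (Suc k)) (map (twin_incl k (Suc k)) (map (\<lambda>l. twin_m k l (i l)) [1..<k]))"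
      by (rule group.hom_list_mult[OF twin_group_group twin_group_group twin_incl_hom])
        (auto intro!: twin_m_carrier)
    moreover have "map (twin_incl k (Suc k)) (map (\<lambda>l. twin_m k l (i l)) [1..<k]) =
        map (\<lambda>l. twin_m (Suc k) l (i l)) [1..<k]"
      by (auto intro!: twin_incl_m)
    ultimately show ?thesis by (simp only:)
  qed
  have split: "?p (Suc k) (Suc k) i =
      ?p (Suc k) k i \<otimes>\<^bsub>twin_group (Suc k)\<^esub> twin_m (Suc k) k (i k)" for i
  proof -
    have "[1..<Suc k] = [1..<k] @ [k]" using assms by simp
    then have "?p (Suc k) (Suc k) i = ?p (Suc k) k i \<otimes>\<^bsub>twin_group (Suc k)\<^esub>
        list_mult (twin_group (Suc k)) [twin_m (Suc k) k (i k)]"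
      by (simp only: map_append list.map)
        (rule list_mult_append; auto intro!: twin_m_carrier)
    then show ?thesis using twin_m_carrier[of k "Suc k"] by (simp add: list_mult_def)
  qed
  show ?thesis
  proof (intro subset_antisym subsetI)
    fix y assume "y \<in> schreier_set (Suc k)"
    then obtain i where i: "\<forall>l\<in>{1..<Suc k}. i l \<le> l" "y = ?p (Suc k) (Suc k) i"
      unfolding schreier_set_def by blast
    have "?p k k i \<in> schreier_set k" unfolding schreier_set_def using i(1) by auto
    moreover have "y = twin_incl k (Suc k) (?p k k i) \<otimes>\<^bsub>twin_group (Suc k)\<^esub> twin_m (Suc k) k (i k)"
      unfolding i(2) split incl ..
    moreover have "i k \<le> k" using i(1) assms by auto
    ultimately show "y \<in> {twin_incl k (Suc k) x \<otimes>\<^bsub>twin_group (Suc k)\<^esub> twin_m (Suc k) k i | x i.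
      x \<in> schreier_set k \<and> i \<le> k}" by blast
  next
    fix y assume "y \<in> {twin_incl k (Suc k) x \<otimes>\<^bsub>twin_group (Suc k)\<^esub> twin_m (Suc k) k i | x i.
      x \<in> schreier_set k \<and> i \<le> k}"
    then obtain i j where i: "\<forall>l\<in>{1..<k}. i l \<le> l" and j: "j \<le> k"
      and y: "y = twin_incl k (Suc k) (?p k k i) \<otimes>\<^bsub>twin_group (Suc k)\<^esub> twin_m (Suc k) k j"
      unfolding schreier_set_def by blast
    \<comment> \<open>The witness is \<open>i\<close> overwritten at \<open>k\<close>; since
      \<open>k\<close> is not in \<open>[1..<k]\<close>, the earlier factors do not change.\<close>
    have "map (\<lambda>l. twin_m (Suc k) l ((i(k := j)) l)) [1..<k] =
        map (\<lambda>l. twin_m (Suc k) l (i l)) [1..<k]"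
      by auto
    then have "y = ?p (Suc k) (Suc k) (i(k := j))"
      unfolding y incl split by (simp only: fun_upd_same)
    moreover have "\<forall>l\<in>{1..<Suc k}. (i(k := j)) l \<le> l" using i j by auto
    ultimately show "y \<in> schreier_set (Suc k)" unfolding schreier_set_def by blast
  qed
qed

text \<open>By induction on the number of strands. The last factor m_{k,i} sends i+1 to k+1, and the
  factor from T_k fixes k+1. Hence a trivial permutation forces i = k, the last factor is 1, and the
  induction hypothesis applies to the rest.\<close>

lemma schreier_set_perm_id:
  "x \<in> schreier_set n \<Longrightarrow> twin_perm n x = id \<Longrightarrow> x = \<one>\<^bsub>twin_group n\<^esub>"
proof (induction n arbitrary: x)
  case 0
  then show ?case by (simp add: schreier_set_trivial)
next
  case (Suc k)
  interpret group "twin_group (Suc k)" by (rule twin_group_group)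
  show ?case
  proof (cases "1 \<le> k")
    case False
    then show ?thesis using Suc.prems by (simp add: schreier_set_trivial)
  next
    case True
    then obtain y i where y: "y \<in> schreier_set k" and i: "i \<le> k"
      and x: "x = twin_incl k (Suc k) y \<otimes>\<^bsub>twin_group (Suc k)\<^esub> twin_m (Suc k) k i"
      using Suc.prems(1) schreier_set_Suc by blast
    have yc: "y \<in> carrier (twin_group k)" using y by (rule schreier_set_carrier)
    have perm_x: "twin_perm (Suc k) x = twin_perm k y \<circ> twin_perm (Suc k) (twin_m (Suc k) k i)"
      unfolding x using yc
      by (simp add: twin_perm_mult twin_incl_carrier twin_m_carrier twin_perm_incl)
    have "i + 1 = twin_perm k y (k + 1)"
      using fun_cong[OF perm_x, of "i + 1"] Suc.prems(2) twin_perm_m[OF i, of "Suc k"] by simp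
    also have "\<dots> = k + 1" by (rule permutes_not_in[OF twin_perm_permutes[OF yc]]) simp
    finally have "i = k" by simp
    have "twin_perm k y = id"
      using perm_x unfolding \<open>i = k\<close> Suc.prems(2) twin_m_self twin_perm_one by simp
    then have "y = \<one>\<^bsub>twin_group k\<^esub>" by (rule Suc.IH[OF y])
    then show ?thesis using \<open>i = k\<close> hom_one[OF twin_incl_hom twin_group_group twin_group_group, of k "Suc k"]
      by (simp add: x twin_m_self)
  qed
qed

section \<open>The pure twin group and the additional generators\<close>

lemma pure_twin_subgroup: "subgroup (pure_twin n) (twin_group n)"
proof -
  interpret group_hom "twin_group n" "sym_group n" "twin_perm n"
    by (simp add: group_hom_def group_hom_axioms_def twin_group_group sym_group_is_group twin_perm_hom)
  show ?thesis unfolding pure_twin_def by (rule subgroup_kernel)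
qed

lemma pure_twin_iff:
  "X \<in> pure_twin n \<longleftrightarrow> X \<in> carrier (twin_group n) \<and> twin_perm n X = id"
  by (simp add: pure_twin_def kernel_def sym_group_one)

text \<open>For n at most 2 no \<open>l\<close> is admissible and the set is empty, which lets the
  recursion over strands start below the range of the theorem.\<close>

definition new_gens :: "nat \<Rightarrow> nat word set set" where
  "new_gens n =
    {conj_by (twin_group n)
      ((twin_gen n (l - 1) \<otimes>\<^bsub>twin_group n\<^esub> twin_gen n l) [^]\<^bsub>twin_group n\<^esub> (3::nat))
      (inv\<^bsub>twin_group n\<^esub> (twin_incl (n - 1) n x \<otimes>\<^bsub>twin_group n\<^esub> twin_m n (n - 1) l))
      | l x. 2 \<le> l \<and> l \<le> n - 1 \<and> x \<in> schreier_set (n - 1)}"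

text \<open>The product s_{l-1} s_l acts as a 3-cycle, so its cube has trivial permutation, and so
  has every conjugate of that cube.\<close>

lemma new_gens_pure:
  assumes "1 < n"
  shows "new_gens n \<subseteq> pure_twin n"
proof
  interpret group "twin_group n" by (rule twin_group_group)
  let ?G = "twin_group n"
  fix y assume "y \<in> new_gens n"
  then obtain l x where l: "2 \<le> l" "l \<le> n - 1" and x: "x \<in> schreier_set (n - 1)"
    and y: "y = conj_by ?G ((twin_gen n (l - 1) \<otimes>\<^bsub>?G\<^esub> twin_gen n l) [^]\<^bsub>?G\<^esub> (3::nat))
      (inv\<^bsub>?G\<^esub> (twin_incl (n - 1) n x \<otimes>\<^bsub>?G\<^esub> twin_m n (n - 1) l))"
    unfolding new_gens_def by blast
  have li: "l - 1 \<in> {1..<n}" "l \<in> {1..<n}" using l assms by auto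
  define c where "c = (twin_gen n (l - 1) \<otimes>\<^bsub>?G\<^esub> twin_gen n l) [^]\<^bsub>?G\<^esub> (3::nat)"
  define b where "b = twin_incl (n - 1) n x \<otimes>\<^bsub>?G\<^esub> twin_m n (n - 1) l"
  have cc: "c \<in> carrier ?G" unfolding c_def using li by (simp add: twin_gen_carrier)
  have bc: "b \<in> carrier ?G" unfolding b_def
    using x assms by (simp add: twin_incl_carrier schreier_set_carrier twin_m_carrier)
  have "twin_perm n c = id"
    unfolding c_def using li
    by (simp add: numeral_3_eq_3 twin_perm_mult twin_gen_carrier twin_perm_gen twin_perm_one)
      (use l in \<open>auto simp: fun_eq_iff Transposition.transpose_def\<close>)
  then have "twin_perm n (b \<otimes>\<^bsub>?G\<^esub> c \<otimes>\<^bsub>?G\<^esub> inv\<^bsub>?G\<^esub> b) = twin_perm n b \<circ> twin_perm n (inv\<^bsub>?G\<^esub> b)"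
    using bc cc by (simp add: twin_perm_mult)
  also have "\<dots> = twin_perm n (b \<otimes>\<^bsub>?G\<^esub> inv\<^bsub>?G\<^esub> b)"
    using bc by (simp only: twin_perm_mult inv_closed)
  finally show "y \<in> pure_twin n"
    using bc cc by (simp add: y[folded b_def c_def] pure_twin_iff conj_by_def twin_perm_one)
qed

lemma twin_incl_pure: "m \<le> n \<Longrightarrow> twin_incl m n ` pure_twin m \<subseteq> pure_twin n"
  by (auto simp: pure_twin_iff twin_incl_carrier twin_perm_incl)

section \<open>Decomposition into cosets with Schreier representatives\<close>

text \<open>The subgroup \<open>H\<close> is left general because the lemma serves twice: with
  \<open>H\<close> the whole pure twin group it drives the recursion in
  \<open>twin_pure_schreier\<close>, and with \<open>H\<close> the generated subgroup it proves the
  theorem.\<close>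

lemma twin_coset_decomposition:
  assumes k: "1 \<le> k"
    and H: "subgroup H (twin_group (Suc k))"
    and pure: "twin_incl k (Suc k) ` pure_twin k \<subseteq> H"
    and gens: "new_gens (Suc k) \<subseteq> H"
    and IH: "\<And>X. X \<in> carrier (twin_group k) \<Longrightarrow>
      \<exists>p\<in>pure_twin k. \<exists>x\<in>schreier_set k. X = p \<otimes>\<^bsub>twin_group k\<^esub> x"
    and X: "X \<in> carrier (twin_group (Suc k))"
  shows "\<exists>h\<in>H. \<exists>y\<in>schreier_set (Suc k). X = h \<otimes>\<^bsub>twin_group (Suc k)\<^esub> y"
proof -
  let ?G = "twin_group (Suc k)" and ?m = "twin_m (Suc k) k" and ?s = "twin_gen (Suc k)"
    and ?\<iota> = "twin_incl k (Suc k)"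
  interpret group ?G by (rule twin_group_group)
  interpret H: subgroup H ?G by (rule H)
  have \<iota>: "?\<iota> x \<in> carrier ?G" if "x \<in> carrier (twin_group k)" for x
    using that by (simp add: twin_incl_carrier)
  have m: "?m i \<in> carrier ?G" for i by (simp add: twin_m_carrier)
  have s: "?s j \<in> carrier ?G" if "j \<in> {1..k}" for j using that by (auto intro!: twin_gen_carrier)
  have mem: "\<exists>h\<in>H. \<exists>y\<in>schreier_set (Suc k). Z = h \<otimes>\<^bsub>?G\<^esub> y"
    if "Z = h \<otimes>\<^bsub>?G\<^esub> (?\<iota> x \<otimes>\<^bsub>?G\<^esub> ?m i)" "h \<in> H" "x \<in> schreier_set k" "i \<le> k" for Z h x i
    using that schreier_set_Suc[OF k] by blast
  \<comment> \<open>For j < k the letter s_j lies in the image of T_k, so x s_j can be rewritten as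
    p x' by \<open>IH\<close>; the pure factor p is absorbed into \<open>h\<close>.\<close>
  have mem': "\<exists>h\<in>H. \<exists>y\<in>schreier_set (Suc k). Z = h \<otimes>\<^bsub>?G\<^esub> y"
    if Z: "Z = h \<otimes>\<^bsub>?G\<^esub> (?\<iota> x \<otimes>\<^bsub>?G\<^esub> (?s j \<otimes>\<^bsub>?G\<^esub> ?m i))" and h: "h \<in> H" and x: "x \<in> schreier_set k"
      and i: "i \<le> k" and j: "j \<in> {1..<k}" for Z h x i j
  proof -
    have xc: "x \<in> carrier (twin_group k)" using x by (rule schreier_set_carrier)
    have jc: "twin_gen k j \<in> carrier (twin_group k)" using j by (rule twin_gen_carrier)
    then obtain p x' where p: "p \<in> pure_twin k" and x': "x' \<in> schreier_set k"
      and eq: "x \<otimes>\<^bsub>twin_group k\<^esub> twin_gen k j = p \<otimes>\<^bsub>twin_group k\<^esub> x'"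
      using IH[of "x \<otimes>\<^bsub>twin_group k\<^esub> twin_gen k j"] xc
      by (meson group.is_monoid monoid.m_closed twin_group_group)
    have pc: "p \<in> carrier (twin_group k)" using p by (simp add: pure_twin_iff)
    have x'c: "x' \<in> carrier (twin_group k)" using x' by (rule schreier_set_carrier)
    have "?\<iota> x \<otimes>\<^bsub>?G\<^esub> ?s j = ?\<iota> p \<otimes>\<^bsub>?G\<^esub> ?\<iota> x'"
      using arg_cong[OF eq, of ?\<iota>] xc jc pc x'c j
      by (simp add: hom_mult[OF twin_incl_hom] twin_incl_gen)
    then have "Z = (h \<otimes>\<^bsub>?G\<^esub> ?\<iota> p) \<otimes>\<^bsub>?G\<^esub> (?\<iota> x' \<otimes>\<^bsub>?G\<^esub> ?m i)"
      unfolding Z using \<iota>[OF xc] \<iota>[OF pc] \<iota>[OF x'c] s[of j] m[of i] j H.mem_carrier[OF h]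
      by (metis atLeastLessThan_iff atLeastAtMost_iff m_assoc m_closed less_imp_le)
    then show ?thesis by (rule mem[OF _ _ x' i]) (use pure p h in auto)
  qed
  show ?thesis using X
  proof (induction X rule: twin_group_induct)
    case one
    \<comment> \<open>Decomposing 1 in T_k and appending m_{k,k} = 1 gives the claim without
      exhibiting an index function.\<close>
    have "\<one>\<^bsub>twin_group k\<^esub> \<in> carrier (twin_group k)"
      by (simp add: group.is_monoid monoid.one_closed twin_group_group)
    then obtain p x where p: "p \<in> pure_twin k" and x: "x \<in> schreier_set k"
      and eq: "\<one>\<^bsub>twin_group k\<^esub> = p \<otimes>\<^bsub>twin_group k\<^esub> x"
      using IH by blast
    have pc: "p \<in> carrier (twin_group k)" using p by (simp add: pure_twin_iff)
    have xc: "x \<in> carrier (twin_group k)" using x by (rule schreier_set_carrier)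
    have "\<one>\<^bsub>?G\<^esub> = ?\<iota> p \<otimes>\<^bsub>?G\<^esub> (?\<iota> x \<otimes>\<^bsub>?G\<^esub> ?m k)"
      using arg_cong[OF eq, of ?\<iota>] hom_one[OF twin_incl_hom twin_group_group twin_group_group, of k "Suc k"]
        \<iota>[OF pc] \<iota>[OF xc] pc xc
      by (simp add: hom_mult[OF twin_incl_hom] twin_m_self)
    then show ?case by (rule mem[OF _ _ x]) (use pure p in auto)
  next
    case (gen X j)
    then obtain h y where h: "h \<in> H" and "y \<in> schreier_set (Suc k)" and X: "X = h \<otimes>\<^bsub>?G\<^esub> y" by blast
    then obtain x i where x: "x \<in> schreier_set k" and i: "i \<le> k"
      and y: "y = ?\<iota> x \<otimes>\<^bsub>?G\<^esub> ?m i"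
      using schreier_set_Suc[OF k] by blast
    have j: "j \<in> {1..<Suc k}" "j \<in> {1..k}" using gen by auto
    have xc: "?\<iota> x \<in> carrier ?G" using x by (simp add: \<iota> schreier_set_carrier)
    have hc: "h \<in> carrier ?G" using h by (rule H.mem_carrier)
    have eq: "X \<otimes>\<^bsub>?G\<^esub> ?s j = h \<otimes>\<^bsub>?G\<^esub> (?\<iota> x \<otimes>\<^bsub>?G\<^esub> (?m i \<otimes>\<^bsub>?G\<^esub> ?s j))"
      using hc xc m s[OF j(2)] by (simp add: X y m_assoc)
    consider "j = i" | "j = i + 1" | "j < i" | "i + 1 < j" by linarith
    then show ?case
    proof cases
      \<comment> \<open>Here i = j is at least 1, so \<open>i - 1\<close> is a true
        predecessor.\<close>
      case 1
      then have e: "?m i \<otimes>\<^bsub>?G\<^esub> ?s j = ?m (i - 1)"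
        using twin_m_step[of "i - 1" k "Suc k"] i j by simp
      show ?thesis by (rule mem[OF eq[unfolded e] h x]) (use i in simp)
    next
      case 2
      then have e: "?m i \<otimes>\<^bsub>?G\<^esub> ?s j = ?m j"
        using twin_m_step[of i k "Suc k"] j m[of j] s[OF j(2)] twin_gen_square[OF j(1)]
        by (simp add: m_assoc)
      show ?thesis by (rule mem[OF eq[unfolded e] h x]) (use j in simp)
    next
      case 3
      then have e: "?m i \<otimes>\<^bsub>?G\<^esub> ?s j = ?s j \<otimes>\<^bsub>?G\<^esub> ?m i"
        using twin_m_commute[OF j(1), of k i] by simp
      show ?thesis by (rule mem'[OF eq[unfolded e] h x i]) (use i j 3 in simp)
    next
      case 4
      let ?a = "?s (j - 1)" and ?r = "twin_m (Suc k) (j - 2) i"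
      let ?d = "?m j \<otimes>\<^bsub>?G\<^esub> (?a \<otimes>\<^bsub>?G\<^esub> ?s j) [^]\<^bsub>?G\<^esub> (3::nat) \<otimes>\<^bsub>?G\<^esub> inv\<^bsub>?G\<^esub> (?m j)"
      \<comment> \<open>\<open>g\<close> is the additional generator for l = j and \<open>x\<close>:
        the correction \<open>?d\<close> from \<open>braid_move\<close>, conjugated so that its
        inverse can move to the left of \<open>x\<close>.\<close>
      define g where "g = ?\<iota> x \<otimes>\<^bsub>?G\<^esub> ?d \<otimes>\<^bsub>?G\<^esub> inv\<^bsub>?G\<^esub> (?\<iota> x)"
      have j1: "j - 1 \<in> {1..<Suc k}" "j - 1 \<in> {1..k}" "j - 1 \<in> {1..<k}" using 4 j by auto
      have r: "?r \<in> carrier ?G" using j by (intro twin_m_carrier) auto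
      have c: "?a \<in> carrier ?G" "?s j \<in> carrier ?G" "?m j \<in> carrier ?G" "?d \<in> carrier ?G"
        using s[OF j1(2)] s[OF j(2)] m by auto
      \<comment> \<open>From i + 1 < j it follows that j - 2 is at least i, so s_j s_{j-1} can be
        isolated inside m_{k,i}.\<close>
      have mi: "?m i = ?m j \<otimes>\<^bsub>?G\<^esub> (?s j \<otimes>\<^bsub>?G\<^esub> (?a \<otimes>\<^bsub>?G\<^esub> ?r))"
      proof -
        have "?m i = ?m (j - 2) \<otimes>\<^bsub>?G\<^esub> ?r" using 4 j by (intro twin_m_split) auto
        moreover have "?m (j - 2) = ?m (j - 1) \<otimes>\<^bsub>?G\<^esub> ?a"
          using twin_m_step[of "j - 2" k "Suc k"] 4 j by (simp add: numeral_2_eq_2 Suc_diff_Suc)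
        moreover have "?m (j - 1) = ?m j \<otimes>\<^bsub>?G\<^esub> ?s j"
          using twin_m_step[of "j - 1" k "Suc k"] 4 j by simp
        ultimately show ?thesis using c r by (simp add: m_assoc)
      qed
      have "?m i \<otimes>\<^bsub>?G\<^esub> ?s j = inv\<^bsub>?G\<^esub> ?d \<otimes>\<^bsub>?G\<^esub> (?a \<otimes>\<^bsub>?G\<^esub> ?m i)"
        unfolding mi
      proof (rule braid_move[OF c(1,2,3) r])
        show "?a \<otimes>\<^bsub>?G\<^esub> ?a = \<one>\<^bsub>?G\<^esub>" by (rule twin_gen_square[OF j1(1)])
        show "?s j \<otimes>\<^bsub>?G\<^esub> ?s j = \<one>\<^bsub>?G\<^esub>" by (rule twin_gen_square[OF j(1)])
        show "?a \<otimes>\<^bsub>?G\<^esub> ?m j = ?m j \<otimes>\<^bsub>?G\<^esub> ?a" using 4 by (intro twin_m_commute[OF j1(1)]) auto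
        show "?s j \<otimes>\<^bsub>?G\<^esub> ?r = ?r \<otimes>\<^bsub>?G\<^esub> ?s j" using 4 j by (intro twin_m_commute[OF j(1)]) auto
      qed
      moreover have "?\<iota> x \<otimes>\<^bsub>?G\<^esub> (inv\<^bsub>?G\<^esub> ?d \<otimes>\<^bsub>?G\<^esub> z) = inv\<^bsub>?G\<^esub> g \<otimes>\<^bsub>?G\<^esub> (?\<iota> x \<otimes>\<^bsub>?G\<^esub> z)"
        if "z \<in> carrier ?G" for z
      proof -
        have "inv\<^bsub>?G\<^esub> g = ?\<iota> x \<otimes>\<^bsub>?G\<^esub> inv\<^bsub>?G\<^esub> ?d \<otimes>\<^bsub>?G\<^esub> inv\<^bsub>?G\<^esub> (?\<iota> x)"
          unfolding g_def using xc c(4) by (simp add: inv_mult_group m_assoc)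
        moreover have "inv\<^bsub>?G\<^esub> (?\<iota> x) \<otimes>\<^bsub>?G\<^esub> (?\<iota> x \<otimes>\<^bsub>?G\<^esub> z) = z"
          using xc that by (simp add: m_assoc[symmetric])
        ultimately show ?thesis using xc c(4) that by (simp add: m_assoc)
      qed
      ultimately have "X \<otimes>\<^bsub>?G\<^esub> ?s j = (h \<otimes>\<^bsub>?G\<^esub> inv\<^bsub>?G\<^esub> g) \<otimes>\<^bsub>?G\<^esub> (?\<iota> x \<otimes>\<^bsub>?G\<^esub> (?a \<otimes>\<^bsub>?G\<^esub> ?m i))"
        unfolding eq using hc xc c m by (simp add: g_def m_assoc)
      moreover have "g \<in> new_gens (Suc k)"
      proof -
        have "g = conj_by ?G ((?a \<otimes>\<^bsub>?G\<^esub> ?s j) [^]\<^bsub>?G\<^esub> (3::nat)) (inv\<^bsub>?G\<^esub> (?\<iota> x \<otimes>\<^bsub>?G\<^esub> ?m j))"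
          unfolding g_def conj_by_def using xc c by (simp add: inv_mult_group m_assoc)
        then show ?thesis unfolding new_gens_def using x 4 j by fastforce
      qed
      then have "h \<otimes>\<^bsub>?G\<^esub> inv\<^bsub>?G\<^esub> g \<in> H" using gens h by auto
      ultimately show ?thesis using x i j1(3) by (rule mem')
    qed
  qed
qed

lemma twin_pure_schreier:
  "X \<in> carrier (twin_group n) \<Longrightarrow>
    \<exists>p\<in>pure_twin n. \<exists>x\<in>schreier_set n. X = p \<otimes>\<^bsub>twin_group n\<^esub> x"
proof (induction n arbitrary: X)
  case 0
  \<comment> \<open>There are no generators, so the induction step is vacuous and the group is
    trivial.\<close>
  from 0 have "X = \<one>\<^bsub>twin_group 0\<^esub>"
    by (induction X rule: twin_group_induct) auto
  then show ?case using subgroup.one_closed[OF pure_twin_subgroup, of 0]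
    by (auto simp: schreier_set_trivial group.is_monoid[OF twin_group_group]
        intro!: bexI[of _ "\<one>\<^bsub>twin_group 0\<^esub>"])
next
  case (Suc k)
  show ?case
  proof (cases "1 \<le> k")
    case True
    show ?thesis
      by (rule twin_coset_decomposition[OF True pure_twin_subgroup _ _ Suc.IH Suc.prems])
        (use True in \<open>simp_all add: twin_incl_pure new_gens_pure\<close>)
  next
    case False
    from Suc.prems False have "X = \<one>\<^bsub>twin_group (Suc k)\<^esub>"
      by (induction X rule: twin_group_induct) auto
    then show ?thesis using subgroup.one_closed[OF pure_twin_subgroup, of "Suc k"] False
      by (auto simp: schreier_set_trivial group.is_monoid[OF twin_group_group]
          intro!: bexI[of _ "\<one>\<^bsub>twin_group (Suc k)\<^esub>"])
  qed
qed

theorem theorem4p2: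
  fixes n :: nat
  assumes "n > 2"
  shows "pure_twin n =
    generate (twin_group n)
      (twin_incl (n - 1) n ` pure_twin (n - 1) \<union>
       {conj_by (twin_group n)
          ((twin_gen n (l - 1) \<otimes>\<^bsub>twin_group n\<^esub> twin_gen n l) [^]\<^bsub>twin_group n\<^esub> (3::nat))
          (inv\<^bsub>twin_group n\<^esub> (twin_incl (n - 1) n x \<otimes>\<^bsub>twin_group n\<^esub> twin_m n (n - 1) l))
        | l x. 2 \<le> l \<and> l \<le> n - 1 \<and> x \<in> schreier_set (n - 1)})"
proof -
  obtain k where k: "n = Suc k" "1 \<le> k" using assms by (cases n) auto
  interpret group "twin_group n" by (rule twin_group_group)
  let ?S = "twin_incl k n ` pure_twin k \<union> new_gens n"
  let ?H = "generate (twin_group n) ?S"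
  have S: "?S \<subseteq> pure_twin n" using k twin_incl_pure[of k n] new_gens_pure[of n] by simp
  have S': "?S \<subseteq> carrier (twin_group n)" using S by (auto simp: pure_twin_iff)
  have sub: "subgroup ?H (twin_group n)" by (rule generate_is_subgroup[OF S'])
  have le: "?H \<subseteq> pure_twin n" by (rule generate_subgroup_incl[OF S pure_twin_subgroup])
  have "pure_twin n \<subseteq> ?H"
  proof
    fix X assume X: "X \<in> pure_twin n"
    then have Xc: "X \<in> carrier (twin_group n)" by (simp add: pure_twin_iff)
    \<comment> \<open>Second use of the decomposition, now relative to the generated subgroup;
      \<open>twin_pure_schreier\<close> supplies its hypothesis on T_k.\<close>
    have "\<exists>h\<in>?H. \<exists>y\<in>schreier_set n. X = h \<otimes>\<^bsub>twin_group n\<^esub> y"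
      unfolding k(1)
    proof (rule twin_coset_decomposition[OF k(2)])
      show "subgroup (generate (twin_group (Suc k)) (twin_incl k (Suc k) ` pure_twin k \<union> new_gens (Suc k)))
        (twin_group (Suc k))" using sub by (simp only: k(1))
      show "X \<in> carrier (twin_group (Suc k))" using Xc by (simp only: k(1))
    qed (auto intro: generate.incl twin_pure_schreier)
    then obtain h y where h: "h \<in> ?H" and y: "y \<in> schreier_set n" and X_eq: "X = h \<otimes>\<^bsub>twin_group n\<^esub> y"
      by blast
    have hp: "h \<in> pure_twin n" using h le by blast
    then have "twin_perm n y = id"
      using X y unfolding X_eq by (simp add: pure_twin_iff twin_perm_mult schreier_set_carrier)
    then have "y = \<one>\<^bsub>twin_group n\<^esub>" by (rule schreier_set_perm_id[OF y])
    then show "X \<in> ?H" using h hp by (simp add: X_eq pure_twin_iff)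
  qed
  with le have "pure_twin n = ?H" by (rule subset_antisym[rotated])
  then show ?thesis by (simp add: new_gens_def k(1))
qed

end
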